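(* Let $\alpha>0$, $z=x+iy$, $r=|z|$, and set $R_\alpha=x^2-y^2-\alpha x+\alpha y$, $I_\alpha=2xy+\alpha x+\alpha y$, $$N_{1,\alpha}=\big(r^2+24+\alpha(x+y)+2\alpha^2\big)R_\alpha+\alpha(-x+y)I_\alpha,\qquad N_{2,\alpha}=\alpha(-x+y)R_\alpha+\big(r^2+24-\alpha(x+y)+2\alpha^2\big)I_\alpha,$$ $$\begin{aligned}P_\alpha={}&r^8+64r^6+1152r^4+9216r^2+36864\\&+\alpha\big(-48x^5+144x^4y+96x^3y^2-768x^3+96x^2y^3+2304x^2y+144xy^4+2304xy^2-48y^5-768y^3\big)\\&+\alpha^2\big(1152r^2+4608\big)\\&+\alpha^3\big(-4x^5+12x^4y+8x^3y^2-64x^3+8x^2y^3+192x^2y+12xy^4+192xy^2-4y^5-64y^3\big)\\&+\alpha^4\big(192r^2+768\big)+\alpha^6\big(8r^2+32\big).\end{aligned}$$ Then $$P_\alpha=N_{1,\alpha}^2+N_{2,\alpha}^2+16\Big(|z^3+\alpha(\alpha^2+12)(1-i)|^2+36|z|^4+576|z|^2+2304\Big)>0,$$ so that $\Psi_{2,\alpha}=(N_{1,\alpha}+iN_{2,\alpha})/\sqrt{P_\alpha}$ satisfies $|\Psi_{2,\alpha}|<1$ on $\mathbb{R}^2$. Moreover $\Psi_{2,\alpha}(z)=0$ if and only if $R_\alpha(z)=I_\alpha(z)=0$, and the zeros of $\Psi_{2,\alpha}$ are exactly the four points $$p_0=0,\quad p_1=\sqrt2\,\alpha e^{-3\pi i/4},\quad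 p_2=\sqrt2\,\alpha e^{-\pi i/12},\quad p_3=\sqrt2\,\alpha e^{7\pi i/12}.$$
   Context: Points of $\mathbb{R}^2$ are identified with complex numbers $z=x+iy$. *)

theory Defs
  imports "HOL-Analysis.Analysis"
begin

text \<open>
  Points of the plane are complex numbers \<open>z\<close>; in each definition
  \<open>x = Re z\<close>, \<open>y = Im z\<close> and \<open>r = cmod z\<close>.
\<close>

definition R_fun :: "real \<Rightarrow> complex \<Rightarrow> real" where
  "R_fun \<alpha> z = (let x = Re z; y = Im z in x^2 - y^2 - \<alpha> * x + \<alpha> * y)"

definition I_fun :: "real \<Rightarrow> complex \<Rightarrow> real" where
  "I_fun \<alpha> z = (let x = Re z; y = Im z in 2 * x * y + \<alpha> * x + \<alpha> * y)"

definition N1_fun :: "real \<Rightarrow> complex \<Rightarrow> real" where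
  "N1_fun \<alpha> z = (let x = Re z; y = Im z; r = cmod z in
     (r^2 + 24 + \<alpha> * (x + y) + 2 * \<alpha>^2) * R_fun \<alpha> z + \<alpha> * (- x + y) * I_fun \<alpha> z)"

definition N2_fun :: "real \<Rightarrow> complex \<Rightarrow> real" where
  "N2_fun \<alpha> z = (let x = Re z; y = Im z; r = cmod z in
     \<alpha> * (- x + y) * R_fun \<alpha> z + (r^2 + 24 - \<alpha> * (x + y) + 2 * \<alpha>^2) * I_fun \<alpha> z)"

definition P_fun :: "real \<Rightarrow> complex \<Rightarrow> real" where
  "P_fun \<alpha> z = (let x = Re z; y = Im z; r = cmod z in
     r^8 + 64 * r^6 + 1152 * r^4 + 9216 * r^2 + 36864
     + \<alpha> * (- 48 * x^5 + 144 * x^4 * y + 96 * x^3 * y^2 - 768 * x^3 + 96 * x^2 * y^3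
            + 2304 * x^2 * y + 144 * x * y^4 + 2304 * x * y^2 - 48 * y^5 - 768 * y^3)
     + \<alpha>^2 * (1152 * r^2 + 4608)
     + \<alpha>^3 * (- 4 * x^5 + 12 * x^4 * y + 8 * x^3 * y^2 - 64 * x^3 + 8 * x^2 * y^3
            + 192 * x^2 * y + 12 * x * y^4 + 192 * x * y^2 - 4 * y^5 - 64 * y^3)
     + \<alpha>^4 * (192 * r^2 + 768)
     + \<alpha>^6 * (8 * r^2 + 32))"

definition Psi2 :: "real \<Rightarrow> complex \<Rightarrow> complex" where
  "Psi2 \<alpha> z =
     (complex_of_real (N1_fun \<alpha> z) + \<i> * complex_of_real (N2_fun \<alpha> z))
       / complex_of_real (sqrt (P_fun \<alpha> z))"

end

theory Submission
  imports Defs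
begin

text \<open>
  In complex notation \<open>R + i I = z\<^sup>2 - \<alpha> (1 - i) cnj z\<close>, and the numerator of \<open>\<Psi>\<close> is the image of
  \<open>(R, I)\<close> under a symmetric matrix with determinant
  \<open>(r\<^sup>2 + 24 + 2 \<alpha>\<^sup>2)\<^sup>2 - 2 \<alpha>\<^sup>2 r\<^sup>2 > 0\<close>, so both vanish together. A nonzero root of
  \<open>z\<^sup>2 = \<alpha> (1 - i) cnj z\<close> has modulus \<open>sqrt 2 \<alpha>\<close>, and then multiplying by \<open>z\<close> turns the equation into
  \<open>z\<^sup>3 = (sqrt 2 \<alpha> exp (-\<pi> i / 12))\<^sup>3\<close>, whose solutions differ by cube roots of unity.
\<close>

text \<open>Only even powers of the modulus occur, so with \<open>s = x^2 + y^2\<close> and the cube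
  written in coordinates both sides are polynomials in \<open>x\<close>, \<open>y\<close> and
  \<alpha>, and the claim is a polynomial identity.\<close>

lemma P_fun_decomposition:
  "P_fun \<alpha> z = (N1_fun \<alpha> z)^2 + (N2_fun \<alpha> z)^2
    + 16 * ((cmod (z^3 + complex_of_real (\<alpha> * (\<alpha>^2 + 12)) * (1 - \<i>)))^2
            + 36 * (cmod z)^4 + 576 * (cmod z)^2 + 2304)"
proof -
  obtain x y where z: "z = Complex x y"
    by (cases z)
  define s where "s = x^2 + y^2"
  have r2: "(cmod z)^2 = s"
    by (simp add: z s_def cmod_power2)
  have r4: "(cmod z)^4 = s^2" and r6: "(cmod z)^6 = s^3" and r8: "(cmod z)^8 = s^4"
    by (simp_all flip: r2 power_mult)
  have "(cmod (z^3 + complex_of_real (\<alpha> * (\<alpha>^2 + 12)) * (1 - \<i>)))^2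
      = (x^3 - 3*x*y^2 + \<alpha> * (\<alpha>^2 + 12))^2 + (3*x^2*y - y^3 - \<alpha> * (\<alpha>^2 + 12))^2"
  proof -
    have "z^3 + complex_of_real (\<alpha> * (\<alpha>^2 + 12)) * (1 - \<i>)
        = Complex (x^3 - 3*x*y^2 + \<alpha> * (\<alpha>^2 + 12)) (3*x^2*y - y^3 - \<alpha> * (\<alpha>^2 + 12))"
      unfolding complex_eq_iff
      by (simp add: z power3_eq_cube power2_eq_square) (simp add: algebra_simps)
    then show ?thesis
      by (simp add: cmod_power2)
  qed
  then show ?thesis
    unfolding P_fun_def N1_fun_def N2_fun_def R_fun_def I_fun_def Let_def r8 r6 r4 r2
    unfolding z complex.sel s_def
    by algebra
qed

text \<open>Strictness comes from the constant 2304, as the other terms of the remainder are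
  nonnegative. Positivity of \<open>P_fun\<close> and the bound on \<open>Psi2\<close> both
  follow.\<close>

lemma P_fun_gt: "(N1_fun \<alpha> z)^2 + (N2_fun \<alpha> z)^2 < P_fun \<alpha> z"
  unfolding P_fun_decomposition by (simp add: add_nonneg_pos)

lemma P_fun_pos: "0 < P_fun \<alpha> z"
  using P_fun_gt[of \<alpha> z] by (metis le_less_trans sum_power2_ge_zero)

lemma cmod_Psi2_less_1: "cmod (Psi2 \<alpha> z) < 1"
proof -
  have "cmod (Psi2 \<alpha> z) = sqrt ((N1_fun \<alpha> z)^2 + (N2_fun \<alpha> z)^2) / sqrt (P_fun \<alpha> z)"
    using P_fun_pos[of \<alpha> z] unfolding Psi2_def norm_divide by (simp add: cmod_def)
  also have "\<dots> < 1"
    using P_fun_gt[of \<alpha> z] P_fun_pos[of \<alpha> z] by simp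
  finally show ?thesis .
qed

lemma Psi2_eq_0_iff_N: "Psi2 \<alpha> z = 0 \<longleftrightarrow> N1_fun \<alpha> z = 0 \<and> N2_fun \<alpha> z = 0"
  using P_fun_pos[of \<alpha> z] by (simp add: Psi2_def complex_eq_iff)

lemma Psi2_eq_0_iff: "Psi2 \<alpha> z = 0 \<longleftrightarrow> R_fun \<alpha> z = 0 \<and> I_fun \<alpha> z = 0"
proof
  assume "R_fun \<alpha> z = 0 \<and> I_fun \<alpha> z = 0"
  then show "Psi2 \<alpha> z = 0"
    by (simp add: Psi2_eq_0_iff_N N1_fun_def N2_fun_def Let_def)
next
  assume "Psi2 \<alpha> z = 0"
  define A where "A = (cmod z)^2 + 24 + 2 * \<alpha>^2"
  define b where "b = \<alpha> * (Re z + Im z)"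
  define c where "c = \<alpha> * (- Re z + Im z)"
  have 1: "(A + b) * R_fun \<alpha> z + c * I_fun \<alpha> z = 0"
    and 2: "c * R_fun \<alpha> z + (A - b) * I_fun \<alpha> z = 0"
    using \<open>Psi2 \<alpha> z = 0\<close> unfolding Psi2_eq_0_iff_N
    by (simp_all add: N1_fun_def N2_fun_def A_def b_def c_def Let_def algebra_simps)
  \<comment> \<open>This is the determinant of the matrix with rows \<open>(A + b, c)\<close> and
    \<open>(c, A - b)\<close>. Here \<open>b^2 + c^2 = 2 * \<alpha>^2 * (cmod z)^2\<close>, which is
    absorbed by the cross term \<open>4 * \<alpha>^2 * (cmod z)^2\<close> of
    \<open>A^2\<close>.\<close>
  have "A^2 - b^2 - c^2 = ((cmod z)^2 + 24)^2 + 2 * \<alpha>^2 * (cmod z)^2 + 96 * \<alpha>^2 + 4 * \<alpha>^4"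
    unfolding A_def b_def c_def cmod_power2 by algebra
  also have "\<dots> > 0"
    by (intro add_pos_nonneg zero_less_power add_nonneg_pos) auto
  finally have det: "A^2 - b^2 - c^2 > 0" .
  \<comment> \<open>Cramer's rule: \<open>A - b\<close> times the first equation minus
    \<open>c\<close> times the second isolates \<open>R_fun\<close>; symmetrically for
    \<open>I_fun\<close>.\<close>
  have "(A^2 - b^2 - c^2) * R_fun \<alpha> z = 0" "(A^2 - b^2 - c^2) * I_fun \<alpha> z = 0"
    using 1 2 by algebra+
  with det show "R_fun \<alpha> z = 0 \<and> I_fun \<alpha> z = 0"
    by simp
qed

lemma R_I_eq_0_iff:
  "R_fun \<alpha> z = 0 \<and> I_fun \<alpha> z = 0 \<longleftrightarrow> z^2 = complex_of_real \<alpha> * (1 - \<i>) * cnj z"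
  by (auto simp: R_fun_def I_fun_def Let_def complex_eq_iff power2_eq_square algebra_simps)

lemma cmod_one_minus_ii: "cmod (1 - \<i>) = sqrt 2"
  by (simp add: cmod_def)

lemma sqrt2_cis: "complex_of_real (sqrt 2) * cis (- (pi/4)) = 1 - \<i>"
  by (simp add: complex_eq_iff cos_45 sin_45)

text \<open>For nonzero \<open>z\<close>, each equation alone forces the modulus
  \<open>sqrt 2 * \<alpha>\<close>: taking norms leaves a power of \<open>cmod z\<close> that
  determines it. On that circle \<open>z * cnj z\<close> is constant, so multiplication by
  \<open>z\<close>, which is reversible, turns one equation into the other.\<close>

lemma root_iff_cube:
  assumes "\<alpha> > 0"
  shows "z^2 = complex_of_real \<alpha> * (1 - \<i>) * cnj z \<longleftrightarrow>
    z = 0 \<or> z^3 = (complex_of_real (sqrt 2 * \<alpha>) * cis (- (pi/12)))^3"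
proof (cases "z = 0")
  case False
  define w where "w = complex_of_real (sqrt 2 * \<alpha>) * cis (- (pi/12))"
  have "w^3 = complex_of_real (\<alpha> * (sqrt 2 * \<alpha>)^2) * (complex_of_real (sqrt 2) * cis (- (pi/12)) ^ 3)"
    by (simp add: w_def power3_eq_cube power2_eq_square)
  \<comment> \<open>The angle \<open>- (pi/12)\<close> is a third of \<open>- (pi/4)\<close>, the
    argument of \<open>1 - \<i>\<close>.\<close>
  also have "cis (- (pi/12)) ^ 3 = cis (- (pi/4))"
    by (simp add: Complex.DeMoivre)
  finally have w3: "w^3 = complex_of_real (\<alpha> * (sqrt 2 * \<alpha>)^2) * (1 - \<i>)"
    unfolding sqrt2_cis .
  have key: "z^2 = complex_of_real \<alpha> * (1 - \<i>) * cnj z \<longleftrightarrow> z^3 = w^3"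
    if r: "cmod z = sqrt 2 * \<alpha>"
  proof -
    have "z * cnj z = complex_of_real ((sqrt 2 * \<alpha>)^2)"
      using complex_norm_square[of z] by (simp flip: r)
    then have "z * (complex_of_real \<alpha> * (1 - \<i>) * cnj z) = w^3"
      unfolding w3 by (simp add: mult_ac)
    moreover have "z * z^2 = z^3"
      by (simp add: power3_eq_cube power2_eq_square)
    ultimately show ?thesis
      using False by (metis mult_left_cancel)
  qed
  have "cmod z = sqrt 2 * \<alpha>" if "z^2 = complex_of_real \<alpha> * (1 - \<i>) * cnj z"
    using arg_cong[OF that, of cmod] assms False
    by (simp add: norm_mult norm_power cmod_one_minus_ii power2_eq_square)
  moreover have "cmod z = sqrt 2 * \<alpha>" if "z^3 = w^3"
  proof -
    have "cmod z ^ 3 = cmod w ^ 3"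
      using that by (metis norm_power)
    then show ?thesis
      using assms by (simp add: power_eq_iff_eq_base w_def norm_mult)
  qed
  ultimately show ?thesis
    using key False unfolding w_def by blast
qed simp

lemma cube_eq_iff:
  fixes z w :: complex
  shows "z^3 = w^3 \<longleftrightarrow> z = w \<or> z = w * cis (2*pi/3) \<or> z = w * cis (- (2*pi/3))"
proof -
  define u where "u = cis (2*pi/3)"
  define v where "v = cis (- (2*pi/3))"
  \<comment> \<open>The sum and product of the two primitive cube roots of unity give
    \<open>(z - w * u) * (z - w * v) = z^2 + z * w + w^2\<close>, the cofactor of
    \<open>z - w\<close> in \<open>z^3 - w^3\<close>.\<close>
  have "u + v = -1" "u * v = 1"
    by (simp_all add: u_def v_def complex_eq_iff cos_120 cis_mult)
  then have "z^3 - w^3 = (z - w) * (z - w * u) * (z - w * v)"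
    by algebra
  then show ?thesis
    by (metis u_def v_def mult_eq_0_iff right_minus_eq)
qed

theorem mainTheorem4:
  fixes \<alpha> :: real
  assumes "\<alpha> > 0"
  shows "(\<forall>z. P_fun \<alpha> z = (N1_fun \<alpha> z)^2 + (N2_fun \<alpha> z)^2
            + 16 * ((cmod (z^3 + complex_of_real (\<alpha> * (\<alpha>^2 + 12)) * (1 - \<i>)))^2
                    + 36 * (cmod z)^4 + 576 * (cmod z)^2 + 2304)
          \<and> P_fun \<alpha> z > 0)
    \<and> (\<forall>z. cmod (Psi2 \<alpha> z) < 1)
    \<and> (\<forall>z. Psi2 \<alpha> z = 0 \<longleftrightarrow> R_fun \<alpha> z = 0 \<and> I_fun \<alpha> z = 0)
    \<and> {z. Psi2 \<alpha> z = 0} =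
        {0,
         complex_of_real (sqrt 2 * \<alpha>) * exp (- (3 * complex_of_real pi * \<i> / 4)),
         complex_of_real (sqrt 2 * \<alpha>) * exp (- (complex_of_real pi * \<i> / 12)),
         complex_of_real (sqrt 2 * \<alpha>) * exp (7 * complex_of_real pi * \<i> / 12)}
    \<and> card {z. Psi2 \<alpha> z = 0} = 4"
proof -
  define p where "p t = complex_of_real (sqrt 2 * \<alpha>) * cis t" for t
  have zeros: "{z. Psi2 \<alpha> z = 0} = {0, p (- (3*pi/4)), p (- (pi/12)), p (7*pi/12)}"
  proof -
    have "p (- (pi/12)) * cis (2*pi/3) = p (7*pi/12)"
      "p (- (pi/12)) * cis (- (2*pi/3)) = p (- (3*pi/4))"
      by (simp_all add: p_def mult.assoc cis_mult)
    then show ?thesis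
      unfolding Psi2_eq_0_iff R_I_eq_0_iff root_iff_cube[OF assms] p_def[symmetric] cube_eq_iff
      by auto
  qed
  \<comment> \<open>Equal points have angles differing by an integer multiple of
    \<open>2*pi\<close>, but the three angles span only \<open>4*pi/3\<close>; the multiplier
    \<open>n\<close> would lie strictly between 0 and 1.\<close>
  have "p s \<noteq> p t" if "s < t" "t - s < 2*pi" for s t
  proof
    assume "p s = p t"
    then have "cis (t - s) = 1"
      using assms by (simp add: p_def flip: cis_divide)
    then have "cos (t - s) = 1"
      by (simp add: complex_eq_iff)
    then obtain n :: int where n: "t - s = of_int n * (2*pi)"
      by (auto simp: cos_one_2pi_int mult.assoc)
    have "0 < of_int n * (2*pi)" "of_int n * (2*pi) < 1 * (2*pi)"
      unfolding n[symmetric] using that by simp_all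
    then have "0 < n" "n < 1"
      by (simp_all add: zero_less_mult_iff)
    then show False
      by simp
  qed
  from this[of "- (3*pi/4)" "- (pi/12)"] this[of "- (3*pi/4)" "7*pi/12"]
    this[of "- (pi/12)" "7*pi/12"]
  have distinct: "p (- (3*pi/4)) \<noteq> p (- (pi/12))" "p (- (3*pi/4)) \<noteq> p (7*pi/12)"
    "p (- (pi/12)) \<noteq> p (7*pi/12)"
    by simp_all
  have "p t \<noteq> 0" for t
    using assms by (simp add: p_def)
  then have "card {z. Psi2 \<alpha> z = 0} = 4"
    unfolding zeros using distinct by (simp add: eq_commute[of 0])
  moreover have "p (- (3*pi/4)) = complex_of_real (sqrt 2 * \<alpha>) * exp (- (3 * complex_of_real pi * \<i> / 4))"
    "p (- (pi/12)) = complex_of_real (sqrt 2 * \<alpha>) * exp (- (complex_of_real pi * \<i> / 12))"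
    "p (7*pi/12) = complex_of_real (sqrt 2 * \<alpha>) * exp (7 * complex_of_real pi * \<i> / 12)"
    by (simp_all add: p_def cis_conv_exp mult_ac)
  ultimately show ?thesis
    using P_fun_decomposition P_fun_pos cmod_Psi2_less_1 Psi2_eq_0_iff zeros by metis
qed

end
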